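(* Let $A \in \mathbb{R}^{n \times n}$ (possibly singular), let $A = M - N$ with $M \in \mathbb{R}^{n\times n}$ nonsingular, let $H = M^{-1} N$, and for $\ell \ge 1$ let $C^{(\ell)} = \sum_{i=0}^{\ell-1} H^i M^{-1}$. Consider flexible GMRES (FGMRES) for $A\boldsymbol{x} = \boldsymbol{b}$ preconditioned at its $k$th iteration by $C^{(\ell_k)}$, i.e. with $\boldsymbol{z}_k^{\mathrm F} = C^{(\ell_k)} \boldsymbol{v}_k^{\mathrm F}$, $\ell_k \in \mathbb{N}$. If $H$ is semiconvergent and, for each iteration $k$ performed, the matrix splitting iterations attain the residual norm $\|\boldsymbol{v}_k^{\mathrm F} - A \boldsymbol{z}_k^{\mathrm F}\| < |c_{k-1}|$ (with $c_0 = 1$), then FGMRES preconditioned by the multistep matrix splitting iterations determines a solution of $A\boldsymbol{x} = \boldsymbol{b}$ for all $\boldsymbol{b} \in \mathcal{R}(A)$ and for all $\boldsymbol{x}_0 \in \mathbb{R}^n$.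
   Context: $\mathcal{R}(\cdot)$ denotes the range and $\|\cdot\|$ the Euclidean norm. A square real matrix $H$ is semiconvergent if $\lim_{i\to\infty} H^i$ exists. FGMRES: given $\boldsymbol{x}_0$, put $\boldsymbol{r}_0 = \boldsymbol{b} - A\boldsymbol{x}_0$; if $\boldsymbol{r}_0 = \boldsymbol{0}$ then $\boldsymbol{x}_0$ is a solution and nothing is done. Otherwise $\beta = \|\boldsymbol{r}_0\|$, $\boldsymbol{v}_1^{\mathrm F} = \boldsymbol{r}_0/\beta$. For $k = 1, 2, \dots$: set $\boldsymbol{z}_k^{\mathrm F} = C^{(\ell_k)} \boldsymbol{v}_k^{\mathrm F}$ (the number $\ell_k$ may vary with $k$); orthogonalize $\boldsymbol{w} = A\boldsymbol{z}_k^{\mathrm F}$ by $h_{i,k}^{\mathrm F} = (\boldsymbol{v}_i^{\mathrm F}, \boldsymbol{w})$, $\boldsymbol{w} := \boldsymbol{w} - h_{i,k}^{\mathrm F}\boldsymbol{v}_i^{\mathrm F}$ for $i = 1, \dots, k$; set $h_{k+1,k}^{\mathrm F} = \|\boldsymbol{w}\|$; if $h_{k+1,k}^{\mathrm F} = 0$ stop, else $\boldsymbol{v}_{k+1}^{\mathrm F} = \boldsymbol{w}/h_{k+1,k}^{\mathrm F}$ and continue. The $k$th iterate is $\boldsymbol{x}_k^{\mathrm F} = \boldsymbol{x}_0 + [\boldsymbol{z}_1^{\mathrm F}, \dots, \boldsymbol{z}_k^{\mathrm F}]\boldsymbol{y}_k$, where $\boldsymbol{y}_k$ minimizes $\|\beta\boldsymbol{e}_1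 - H_{k+1,k}^{\mathrm F}\boldsymbol{y}\|$ over $\boldsymbol{y} \in \mathbb{R}^k$, $H_{k+1,k}^{\mathrm F} = \{h_{i,j}^{\mathrm F}\} \in \mathbb{R}^{(k+1)\times k}$ is upper Hessenberg and $\boldsymbol{e}_1$ is the first column of the identity. "Determines a solution" means that $A\boldsymbol{x}_k^{\mathrm F} = \boldsymbol{b}$ for some $k \geq 0$ (with $\boldsymbol{x}_0^{\mathrm F} = \boldsymbol{x}_0$). The scalars $c_k$ come from the QR factorization of $H_{k+1,k}^{\mathrm F}$ by Givens rotations: $\Omega_k \cdots \Omega_1 H_{k+1,k}^{\mathrm F}$ is upper triangular, where $\Omega_i = \mathrm{I}_{i-1} \oplus \begin{bmatrix} c_i & s_i \\ -s_i & c_i\end{bmatrix} \oplus \mathrm{I}_{k-i}$ and $c_k, s_k \in \mathbb{R}$ are chosen with $c_k^2 + s_k^2 = 1$ so that the $(k+1,k)$ entry of $\Omega_{k-1}\cdots\Omega_1 H_{k+1,k}^{\mathrm F}$ is annihilated by $\Omega_k$ (here $\Omega_1,\dots,\Omega_{k-1}$ are extended to size $k+1$ by identity blocks). *)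

theory Defs
  imports "HOL-Analysis.Analysis"
begin

(* The class operation (^) on real^'n^'n is the entrywise power, hence this definition. *)
primrec mat_power :: "real^'n^'n \<Rightarrow> nat \<Rightarrow> real^'n^'n" where
  "mat_power H 0 = mat 1"
| "mat_power H (Suc i) = H ** mat_power H i"

definition semiconvergent :: "real^'n^'n \<Rightarrow> bool" where
  "semiconvergent H \<longleftrightarrow> convergent (mat_power H)"

definition multistep_precond :: "real^'n^'n \<Rightarrow> real^'n^'n \<Rightarrow> nat \<Rightarrow> real^'n^'n" where
  "multistep_precond M H l = (\<Sum>i<l. mat_power H i ** matrix_inv M)"

(* P k is the preconditioner of the k-th iteration and r0 the initial residual; the
   indices of v, z, h, P start at 1.  fgmres_w A P r0 k i is the vector w of iteration k
   after orthogonalization against v_1, ..., v_i (i \<le> k).  The clause v_0 = 0 and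
   the case i \<ge> k of fgmres_w only make the functions total. *)
function fgmres_v :: "real^'n^'n \<Rightarrow> (nat \<Rightarrow> real^'n^'n) \<Rightarrow> real^'n \<Rightarrow> nat \<Rightarrow> real^'n"
  and fgmres_w :: "real^'n^'n \<Rightarrow> (nat \<Rightarrow> real^'n^'n) \<Rightarrow> real^'n \<Rightarrow> nat \<Rightarrow> nat \<Rightarrow> real^'n"
where
  "fgmres_v A P r0 0 = 0"
| "fgmres_v A P r0 (Suc 0) = r0 /\<^sub>R norm r0"
| "fgmres_v A P r0 (Suc (Suc k)) =
     fgmres_w A P r0 (Suc k) (Suc k) /\<^sub>R norm (fgmres_w A P r0 (Suc k) (Suc k))"
| "fgmres_w A P r0 k 0 = A *v (P k *v fgmres_v A P r0 k)"
| "fgmres_w A P r0 k (Suc i) =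
     (if i < k
      then fgmres_w A P r0 k i
             - (fgmres_v A P r0 (Suc i) \<bullet> fgmres_w A P r0 k i) *\<^sub>R fgmres_v A P r0 (Suc i)
      else fgmres_w A P r0 k i)"
  by pat_completeness auto
termination
  by (relation "measures [\<lambda>x. case x of Inl (A, P, r0, k) \<Rightarrow> k | Inr (A, P, r0, k, i) \<Rightarrow> k,
                          \<lambda>x. case x of Inl _ \<Rightarrow> 0 | Inr (A, P, r0, k, i) \<Rightarrow> Suc i]") auto

definition fgmres_z :: "real^'n^'n \<Rightarrow> (nat \<Rightarrow> real^'n^'n) \<Rightarrow> real^'n \<Rightarrow> nat \<Rightarrow> real^'n" where
  "fgmres_z A P r0 k = P k *v fgmres_v A P r0 k"

definition fgmres_h :: "real^'n^'n \<Rightarrow> (nat \<Rightarrow> real^'n^'n) \<Rightarrow> real^'n \<Rightarrow> nat \<Rightarrow> nat \<Rightarrow> real" where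
  "fgmres_h A P r0 i k =
     (if 1 \<le> i \<and> i \<le> k then fgmres_v A P r0 i \<bullet> fgmres_w A P r0 k (i - 1)
      else if i = k + 1 then norm (fgmres_w A P r0 k k)
      else 0)"

definition fgmres_performs :: "real^'n^'n \<Rightarrow> (nat \<Rightarrow> real^'n^'n) \<Rightarrow> real^'n \<Rightarrow> nat \<Rightarrow> bool" where
  "fgmres_performs A P r0 k \<longleftrightarrow>
     1 \<le> k \<and> r0 \<noteq> 0 \<and> (\<forall>j\<in>{1..<k}. fgmres_h A P r0 (j + 1) j \<noteq> 0)"

(* The Euclidean norm of beta e_1 - H_{k+1,k} y, where only y 1, ..., y k are used. *)
definition fgmres_lsq :: "real^'n^'n \<Rightarrow> (nat \<Rightarrow> real^'n^'n) \<Rightarrow> real^'n \<Rightarrow> nat \<Rightarrow> (nat \<Rightarrow> real) \<Rightarrow> real"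
where
  "fgmres_lsq A P r0 k y =
     L2_set (\<lambda>i. (if i = 1 then norm r0 else 0) - (\<Sum>j=1..k. fgmres_h A P r0 i j * y j)) {1..k+1}"

(* A relation, since y_k need not be unique when h_{k+1,k} = 0.
   X k is constrained only for k = 0 and for performed iterations. *)
definition fgmres_iterates ::
  "real^'n^'n \<Rightarrow> (nat \<Rightarrow> real^'n^'n) \<Rightarrow> real^'n \<Rightarrow> real^'n \<Rightarrow> (nat \<Rightarrow> real^'n) \<Rightarrow> bool" where
  "fgmres_iterates A P b x0 X \<longleftrightarrow>
     (let r0 = b - A *v x0 in
       X 0 = x0 \<and>
       (\<forall>k. fgmres_performs A P r0 k \<longrightarrow>
          (\<exists>y. is_arg_min (fgmres_lsq A P r0 k) (\<lambda>_. True) y \<and>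
               X k = x0 + (\<Sum>j=1..k. y j *\<^sub>R fgmres_z A P r0 j))))"

(* Required for every choice of the minimizers y_k. *)
definition fgmres_determines_solution ::
  "real^'n^'n \<Rightarrow> (nat \<Rightarrow> real^'n^'n) \<Rightarrow> real^'n \<Rightarrow> real^'n \<Rightarrow> bool" where
  "fgmres_determines_solution A P b x0 \<longleftrightarrow>
     (\<forall>X. fgmres_iterates A P b x0 X \<longrightarrow>
        (\<exists>k. (k = 0 \<or> fgmres_performs A P (b - A *v x0) k) \<and> A *v X k = b))"

definition givens :: "(nat \<Rightarrow> real) \<Rightarrow> (nat \<Rightarrow> real) \<Rightarrow> nat \<Rightarrow> nat \<Rightarrow> nat \<Rightarrow> real" where
  "givens c s i p q =
     (if p = i \<and> q = i then c i
      else if p = i \<and> q = i + 1 then s i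
      else if p = i + 1 \<and> q = i then - s i
      else if p = i + 1 \<and> q = i + 1 then c i
      else if p = q then 1 else 0)"

(* givens_prod c s m T r is the matrix Omega_r ... Omega_1 T, where T has rows 1, ..., m. *)
primrec givens_prod ::
  "(nat \<Rightarrow> real) \<Rightarrow> (nat \<Rightarrow> real) \<Rightarrow> nat \<Rightarrow> (nat \<Rightarrow> nat \<Rightarrow> real) \<Rightarrow> nat \<Rightarrow> nat \<Rightarrow> nat \<Rightarrow> real" where
  "givens_prod c s m T 0 p q = T p q"
| "givens_prod c s m T (Suc r) p q =
     (\<Sum>l=1..m. givens c s (Suc r) p l * givens_prod c s m T r l q)"

definition fgmres_givens ::
  "real^'n^'n \<Rightarrow> (nat \<Rightarrow> real^'n^'n) \<Rightarrow> real^'n \<Rightarrow> (nat \<Rightarrow> real) \<Rightarrow> (nat \<Rightarrow> real) \<Rightarrow> bool" where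
  "fgmres_givens A P r0 c s \<longleftrightarrow>
     (\<forall>k. fgmres_performs A P r0 k \<longrightarrow>
        (c k)\<^sup>2 + (s k)\<^sup>2 = 1 \<and>
        givens_prod c s (k + 1) (fgmres_h A P r0) k (k + 1) k = 0)"

end

theory Submission
  imports Defs
begin

text \<open>
  Let \<open>k\<close> be the iteration at which FGMRES breaks down, which exists because the \<open>v\<^sub>i\<close> are
  orthonormal. The last row \<open>q\<close> of \<open>\<Omega>\<^bsub>k-1\<^esub> \<dots> \<Omega>\<^sub>1\<close> is a unit vector with last entry \<open>c\<^bsub>k-1\<^esub>\<close>,
  orthogonal to the columns \<open>1, \<dots>, k - 1\<close> of the Hessenberg matrix, so \<open>u = \<Sum>\<^sub>i q\<^sub>i v\<^sub>i\<close> is a unit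
  vector orthogonal to \<open>A z\<^sub>1, \<dots>, A z\<^bsub>k-1\<^esub>\<close>. If \<open>u\<close> were also orthogonal to \<open>A z\<^sub>k\<close>, then
  \<open>\<parallel>v\<^sub>k - A z\<^sub>k\<parallel> \<ge> \<bar>u \<bullet> (v\<^sub>k - A z\<^sub>k)\<bar> = \<bar>c\<^bsub>k-1\<^esub>\<bar>\<close>, against the hypothesis. Hence
  \<open>A z\<^sub>1, \<dots>, A z\<^sub>k\<close> span all of \<open>span {v\<^sub>1, \<dots>, v\<^sub>k}\<close>, in particular \<open>r\<^sub>0\<close>, and the least squares
  problem has residual zero.
\<close>

section \<open>Finite linear combinations and orthonormal families\<close>

text \<open>The combinations of the family form a subspace that contains its members, hence its
  span. Coefficients belong to indices rather than to vectors, so repetitions among the vectors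
  \<open>A *v z j\<close> do no harm.\<close>

lemma span_image_finite_sum:
  fixes f :: "'i \<Rightarrow> 'a::real_vector"
  assumes "finite I" "x \<in> span (f ` I)"
  obtains y where "x = (\<Sum>i\<in>I. y i *\<^sub>R f i)"
proof -
  let ?S = "range (\<lambda>y. \<Sum>i\<in>I. y i *\<^sub>R f i)"
  have "subspace ?S"
  proof (rule subspaceI)
    show "0 \<in> ?S" by (rule range_eqI[of _ _ "\<lambda>_. 0"]) simp
  next
    fix a b assume "a \<in> ?S" "b \<in> ?S"
    then obtain y z where "a = (\<Sum>i\<in>I. y i *\<^sub>R f i)" "b = (\<Sum>i\<in>I. z i *\<^sub>R f i)" by blast
    then show "a + b \<in> ?S"
      by (intro range_eqI[of _ _ "\<lambda>i. y i + z i"]) (simp add: scaleR_add_left sum.distrib)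
  next
    fix r a assume "a \<in> ?S"
    then obtain y where "a = (\<Sum>i\<in>I. y i *\<^sub>R f i)" by blast
    then show "r *\<^sub>R a \<in> ?S"
      by (intro range_eqI[of _ _ "\<lambda>i. r * y i"]) (simp add: scaleR_sum_right)
  qed
  moreover have "f ` I \<subseteq> ?S"
  proof
    fix a assume "a \<in> f ` I"
    then obtain j where j: "j \<in> I" "a = f j" by blast
    have "(\<Sum>i\<in>I. (if i = j then 1 else 0) *\<^sub>R f i) = (\<Sum>i\<in>I. if i = j then f j else 0)"
      by (rule sum.cong) auto
    also have "\<dots> = a" using j assms(1) by simp
    finally show "a \<in> ?S" by (intro range_eqI[of _ _ "\<lambda>i. if i = j then 1 else 0"]) simp
  qed
  ultimately have "span (f ` I) \<subseteq> ?S" by (rule span_minimal[rotated])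
  with assms(2) that show thesis by blast
qed

definition orthonormal_on :: "('i \<Rightarrow> 'a::real_inner) \<Rightarrow> 'i set \<Rightarrow> bool" where
  "orthonormal_on v I \<longleftrightarrow> (\<forall>i\<in>I. \<forall>j\<in>I. v i \<bullet> v j = (if i = j then 1 else 0))"

lemma orthonormal_on_inner_sum:
  assumes "orthonormal_on v I" "finite I" "j \<in> I"
  shows "v j \<bullet> (\<Sum>i\<in>I. a i *\<^sub>R v i) = a j"
proof -
  have "v j \<bullet> (\<Sum>i\<in>I. a i *\<^sub>R v i) = (\<Sum>i\<in>I. if i = j then a j else 0)"
    unfolding inner_sum_right
    using assms by (intro sum.cong) (auto simp: orthonormal_on_def)
  with assms show ?thesis by simp
qed

lemma orthonormal_on_sum_inner_sum:
  assumes "orthonormal_on v I" "finite I"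
  shows "(\<Sum>i\<in>I. a i *\<^sub>R v i) \<bullet> (\<Sum>i\<in>I. b i *\<^sub>R v i) = (\<Sum>i\<in>I. a i * b i)"
  unfolding inner_sum_left
  using orthonormal_on_inner_sum[OF assms] by (intro sum.cong) auto

lemma orthonormal_on_card_le_DIM:
  fixes v :: "'i \<Rightarrow> 'a::euclidean_space"
  assumes "orthonormal_on v I"
  shows "card I \<le> DIM('a)"
proof -
  have one: "v i \<bullet> v j = (if i = j then 1 else 0)" if "i \<in> I" "j \<in> I" for i j
    using assms that unfolding orthonormal_on_def by blast
  have "inj_on v I"
    by (rule inj_onI) (metis one zero_neq_one)
  moreover have "pairwise orthogonal (v ` I)"
    unfolding pairwise_def orthogonal_def using one by auto
  moreover have "0 \<notin> v ` I"
    using one by force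
  ultimately show ?thesis
    using pairwise_orthogonal_independent independent_bound card_image by metis
qed

section \<open>Last rows of products of Givens rotations\<close>

text \<open>Row \<open>k + 1\<close> of \<open>\<Omega>\<^sub>k \<dots> \<Omega>\<^sub>1\<close>; only the entries \<open>1, \<dots>, k + 1\<close> are meaningful.\<close>

fun givens_last_row :: "(nat \<Rightarrow> real) \<Rightarrow> (nat \<Rightarrow> real) \<Rightarrow> nat \<Rightarrow> nat \<Rightarrow> real" where
  "givens_last_row c s 0 i = 1"
| "givens_last_row c s (Suc k) i =
     (if i = k + 2 then c (Suc k) else - s (Suc k) * givens_last_row c s k i)"

lemma sum_givens_last_row_Suc:
  "(\<Sum>i=1..k+2. givens_last_row c s (Suc k) i * f i) =
     - s (Suc k) * (\<Sum>i=1..k+1. givens_last_row c s k i * f i) + c (Suc k) * f (k + 2)"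
proof -
  have "(\<Sum>i=1..k+2. givens_last_row c s (Suc k) i * f i) =
        (\<Sum>i=1..k+1. givens_last_row c s (Suc k) i * f i) + c (Suc k) * f (k + 2)"
    by simp
  also have "(\<Sum>i=1..k+1. givens_last_row c s (Suc k) i * f i) =
             (\<Sum>i=1..k+1. - s (Suc k) * (givens_last_row c s k i * f i))"
    by (intro sum.cong) auto
  also have "\<dots> = - s (Suc k) * (\<Sum>i=1..k+1. givens_last_row c s k i * f i)"
    by (rule sum_distrib_left [symmetric])
  finally show ?thesis .
qed

lemma sum_givens_Suc_row:
  assumes "r + 2 \<le> m"
  shows "(\<Sum>l=1..m. givens c s (Suc r) (r + 2) l * f l) =
           - s (Suc r) * f (r + 1) + c (Suc r) * f (r + 2)"
proof -
  have "(\<Sum>l=1..m. givens c s (Suc r) (r + 2) l * f l) =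
        (\<Sum>l\<in>{r+1, r+2}. givens c s (Suc r) (r + 2) l * f l)"
    using assms by (intro sum.mono_neutral_right) (auto simp: givens_def)
  then show ?thesis by (simp add: givens_def)
qed

lemma sum_givens_later_row:
  assumes "r + 2 < p" "p \<le> m"
  shows "(\<Sum>l=1..m. givens c s (Suc r) p l * f l) = f p"
proof -
  have "(\<Sum>l=1..m. givens c s (Suc r) p l * f l) = (\<Sum>l\<in>{p}. givens c s (Suc r) p l * f l)"
    using assms by (intro sum.mono_neutral_right) (auto simp: givens_def)
  with assms show ?thesis by (simp add: givens_def)
qed

text \<open>The first \<open>r\<close> rotations mix only rows up to \<open>r + 1\<close>.\<close>

lemma givens_prod_later_row:
  "r + 1 < p \<Longrightarrow> p \<le> m \<Longrightarrow> givens_prod c s m T r p j = T p j"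
  by (induction r) (auto simp: sum_givens_later_row simp del: One_nat_def)

text \<open>This turns the annihilation condition of \<open>fgmres_givens\<close> into an
  orthogonality between the row and a column of \<open>T\<close>. In the induction, row
  \<open>k + 2\<close> of \<open>T\<close> is still untouched when the rotation \<open>Suc k\<close>
  mixes it with row \<open>k + 1\<close>.\<close>

lemma givens_prod_last_row:
  assumes "k + 1 \<le> m"
  shows "givens_prod c s m T k (k + 1) j = (\<Sum>i=1..k+1. givens_last_row c s k i * T i j)"
  using assms
proof (induction k)
  case (Suc k)
  have "givens_prod c s m T (Suc k) (Suc k + 1) j =
        (\<Sum>l=1..m. givens c s (Suc k) (k + 2) l * givens_prod c s m T k l j)"
    by simp
  also have "\<dots> = - s (Suc k) * givens_prod c s m T k (k + 1) j
                   + c (Suc k) * givens_prod c s m T k (k + 2) j"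
    using Suc.prems by (intro sum_givens_Suc_row) simp
  also have "\<dots> = (\<Sum>i=1..k+2. givens_last_row c s (Suc k) i * T i j)"
    using Suc by (simp only: sum_givens_last_row_Suc) (simp add: givens_prod_later_row)
  finally show ?case by simp
qed simp

text \<open>Each rotation scales the previous unit row by \<open>- s (Suc k)\<close> and appends the
  entry \<open>c (Suc k)\<close>.\<close>

lemma givens_last_row_norm:
  assumes "\<And>j. j \<in> {1..k} \<Longrightarrow> (c j)\<^sup>2 + (s j)\<^sup>2 = 1"
  shows "(\<Sum>i=1..k+1. (givens_last_row c s k i)\<^sup>2) = 1"
  using assms
proof (induction k)
  case (Suc k)
  have "(\<Sum>i=1..k+1. (givens_last_row c s (Suc k) i)\<^sup>2) =
        (\<Sum>i=1..k+1. (s (Suc k))\<^sup>2 * (givens_last_row c s k i)\<^sup>2)"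
    by (intro sum.cong) (auto simp: power_mult_distrib)
  also have "\<dots> = (s (Suc k))\<^sup>2"
    using Suc by (simp flip: sum_distrib_left)
  finally show ?case using Suc.prems[of "Suc k"] by simp
qed simp

section \<open>The Arnoldi process: orthonormality and breakdown\<close>

context
  fixes A :: "real^'n^'n" and P :: "nat \<Rightarrow> real^'n^'n" and r0 :: "real^'n"
begin

abbreviation (input) "v \<equiv> fgmres_v A P r0"
abbreviation (input) "w \<equiv> fgmres_w A P r0"
abbreviation (input) "z \<equiv> fgmres_z A P r0"
abbreviation (input) "h \<equiv> fgmres_h A P r0"
abbreviation (input) "performs \<equiv> fgmres_performs A P r0"

lemma fgmres_performs_mono:
  assumes "performs k" "1 \<le> j" "j \<le> k"
  shows "performs j"
  using assms by (auto simp: fgmres_performs_def)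

text \<open>Breakdown is covered: there both sides vanish. Hence \<open>fgmres_arnoldi\<close> also
  applies to the last iteration.\<close>

lemma fgmres_w_full_eq:
  assumes "1 \<le> k"
  shows "w k k = h (k + 1) k *\<^sub>R v (k + 1)"
proof -
  from assms obtain m where "k = Suc m" by (cases k) auto
  then show ?thesis by (cases "w k k = 0") (simp_all add: fgmres_h_def)
qed

lemma fgmres_w_eq:
  assumes "i \<le> k"
  shows "w k i = A *v z k - (\<Sum>j=1..i. h j k *\<^sub>R v j)"
  using assms
proof (induction i)
  case 0
  show ?case by (simp add: fgmres_z_def)
next
  case (Suc i)
  then show ?case by (simp add: fgmres_h_def)
qed

lemma fgmres_arnoldi:
  assumes "1 \<le> k"
  shows "A *v z k = (\<Sum>j=1..k+1. h j k *\<^sub>R v j)"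
  using fgmres_w_eq[of k k] fgmres_w_full_eq[OF assms] by simp

text \<open>Modified Gram-Schmidt: subtracting a multiple of \<open>v (Suc i)\<close> creates
  orthogonality to it and preserves the orthogonality to the earlier vectors.\<close>

lemma fgmres_w_orthogonal:
  assumes "orthonormal_on v {1..k}" "i \<le> k" "j \<in> {1..i}"
  shows "v j \<bullet> w k i = 0"
  using assms(2,3)
proof (induction i)
  case (Suc i)
  have "v j \<bullet> v (Suc i) = (if j = Suc i then 1 else 0)"
    using assms(1) Suc.prems by (auto simp: orthonormal_on_def)
  with Suc show ?case by (auto simp: inner_diff_right)
qed simp

lemma fgmres_orthonormal:
  assumes "performs k"
  shows "orthonormal_on v {1..k}"
  using assms
proof (induction k)
  case (Suc k)
  show ?case
  proof (cases "k = 0")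
    case True
    then show ?thesis
      using Suc.prems by (auto simp: orthonormal_on_def fgmres_performs_def norm_eq_sqrt_inner
          real_sqrt_mult_self field_simps)
  next
    case False
    then have k: "1 \<le> k" by simp
    then have orth: "orthonormal_on v {1..k}"
      using Suc fgmres_performs_mono[of "Suc k" k] by simp
    have "h (k + 1) k \<noteq> 0"
      using Suc.prems k by (auto simp: fgmres_performs_def)
    moreover from this have "w k k \<noteq> 0" by (simp add: fgmres_h_def)
    moreover obtain m where "k = Suc m" using k by (cases k) auto
    ultimately have eq: "v (Suc k) = w k k /\<^sub>R norm (w k k)" and "w k k \<noteq> 0"
      by simp_all
    then have "v (Suc k) \<bullet> v (Suc k) = 1"
      by (simp add: dot_square_norm power2_eq_square field_simps)
    moreover have "v j \<bullet> v (Suc k) = 0" if "j \<in> {1..k}" for j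
      using fgmres_w_orthogonal[OF orth order_refl that] eq by simp
    ultimately show ?thesis
      using orth unfolding orthonormal_on_def
      by (auto simp: le_Suc_eq inner_commute)
  qed
qed (simp add: orthonormal_on_def)

lemma fgmres_breakdown:
  assumes "r0 \<noteq> 0"
  obtains k where "performs k" "h (k + 1) k = 0"
proof -
  have "\<not> performs (Suc CARD('n))"
    using orthonormal_on_card_le_DIM[OF fgmres_orthonormal, of "Suc CARD('n)"] by auto
  then have ex: "\<exists>k. 1 \<le> k \<and> \<not> performs k" by auto
  \<comment> \<open>The first iteration that is not performed. It is not the first of all, so its
    predecessor \<open>k\<close> is performed, and only \<open>h (k + 1) k = 0\<close> can have
    stopped the process.\<close>
  define m where "m = (LEAST k. 1 \<le> k \<and> \<not> performs k)"
  have m: "1 \<le> m" "\<not> performs m"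
    using LeastI_ex[OF ex] by (simp_all add: m_def)
  then obtain k where k: "m = Suc k" by (cases m) auto
  have "performs 1" using assms by (simp add: fgmres_performs_def)
  with m k have "1 \<le> k" by (cases k) auto
  moreover have "\<not> (1 \<le> k \<and> \<not> performs k)"
    using not_less_Least[of k "\<lambda>k. 1 \<le> k \<and> \<not> performs k"] k by (simp add: m_def)
  ultimately have "performs k" by simp
  moreover have "h (k + 1) k = 0"
    using m k calculation by (auto simp: fgmres_performs_def less_Suc_eq)
  ultimately show thesis by (rule that)
qed

section \<open>The initial residual lies in the span of the vectors \<open>A *v z j\<close>\<close>

text \<open>The newest column is annihilated by the choice of its rotation. For an older column, the
  next row is a multiple of a row already orthogonal to it plus one new entry, which meets a zero of
  the Hessenberg matrix.\<close>

lemma givens_last_row_annihilates: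
  assumes "fgmres_givens A P r0 c s" "performs (Suc k)" "1 \<le> j" "j \<le> k"
  shows "(\<Sum>i=1..k+1. givens_last_row c s k i * h i j) = 0"
  using assms(2-)
proof (induction k)
  case (Suc k)
  have perf: "performs (Suc k)"
    using fgmres_performs_mono[OF Suc.prems(1)] by simp
  show ?case
  proof (cases "j = Suc k")
    case True
    with assms(1) perf have "givens_prod c s (Suc k + 1) h (Suc k) (Suc k + 1) j = 0"
      unfolding fgmres_givens_def by blast
    then show ?thesis by (simp only: givens_prod_last_row)
  next
    case False
    then have "j \<le> k" using Suc.prems by simp
    moreover from this have "h (k + 2) j = 0" by (simp add: fgmres_h_def)
    moreover have "(\<Sum>i=1..k+1. givens_last_row c s k i * h i j) = 0"
      using Suc.IH[OF perf] Suc.prems \<open>j \<le> k\<close> by blast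
    ultimately show ?thesis
      using sum_givens_last_row_Suc[of c s k "\<lambda>i. h i j"] by (simp only:) simp
  qed
qed simp

text \<open>Before breakdown the Arnoldi relation can be solved for \<open>v (m + 1)\<close>,
  because \<open>h (m + 1) m\<close> is nonzero. So, modulo the images \<open>A *v z j\<close> with
  \<open>j < k\<close>, all basis vectors are multiples of \<open>v 1\<close>, and a single further
  direction has to be gained.\<close>

lemma fgmres_v_mod_v1:
  assumes "performs k" "i \<in> {1..k}"
  shows "\<exists>a. v i - a *\<^sub>R v 1 \<in> span ((\<lambda>j. A *v z j) ` {1..<k})"
  using assms(2)
proof (induction i rule: less_induct)
  case (less i)
  let ?S = "span ((\<lambda>j. A *v z j) ` {1..<k})"
  show ?case
  proof (cases "i = 1")
    case True
    then show ?thesis by (intro exI[of _ 1]) (simp add: span_zero)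
  next
    case False
    then obtain m where m: "i = m + 1" "1 \<le> m" "m < k"
      using less.prems by (cases i) auto
    have "\<forall>j\<in>{1..m}. \<exists>a. v j - a *\<^sub>R v 1 \<in> ?S"
      using less.IH m by auto
    then obtain a where a: "\<And>j. j \<in> {1..m} \<Longrightarrow> v j - a j *\<^sub>R v 1 \<in> ?S"
      by metis
    let ?H = "h (m + 1) m"
    have H: "?H \<noteq> 0"
      using assms(1) m by (auto simp: fgmres_performs_def)
    have "A *v z m - (\<Sum>j=1..m. h j m *\<^sub>R (v j - a j *\<^sub>R v 1)) \<in> ?S"
    proof (rule span_diff)
      show "A *v z m \<in> ?S" using m by (intro span_base) auto
      show "(\<Sum>j=1..m. h j m *\<^sub>R (v j - a j *\<^sub>R v 1)) \<in> ?S"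
        using a by (intro span_sum span_mul)
    qed
    then have "inverse ?H *\<^sub>R (A *v z m - (\<Sum>j=1..m. h j m *\<^sub>R (v j - a j *\<^sub>R v 1))) \<in> ?S"
      by (rule span_mul)
    also have "A *v z m - (\<Sum>j=1..m. h j m *\<^sub>R (v j - a j *\<^sub>R v 1)) =
               ?H *\<^sub>R v i + (\<Sum>j=1..m. h j m * a j) *\<^sub>R v 1"
      unfolding scaleR_diff_right sum_subtractf scaleR_sum_left scaleR_scaleR
      using fgmres_arnoldi[OF m(2)] m(1) by simp
    also have "inverse ?H *\<^sub>R \<dots> = v i - (- inverse ?H * (\<Sum>j=1..m. h j m * a j)) *\<^sub>R v 1"
      using H by (simp add: scaleR_add_right)
    finally show ?thesis by blast
  qed
qed

lemma fgmres_initial_residual_in_span: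
  assumes givens: "fgmres_givens A P r0 c s" and c0: "c 0 = 1"
    and perf: "performs k" and breakdown: "h (k + 1) k = 0"
    and residual: "norm (v k - A *v z k) < \<bar>c (k - 1)\<bar>"
  shows "r0 \<in> span ((\<lambda>j. A *v z j) ` {1..k})"
proof -
  let ?S = "span ((\<lambda>j. A *v z j) ` {1..<k})"
  let ?T = "span ((\<lambda>j. A *v z j) ` {1..k})"
  obtain m where k: "k = Suc m"
    using perf by (cases k) (auto simp: fgmres_performs_def)
  have orth: "orthonormal_on v {1..k}" by (rule fgmres_orthonormal[OF perf])
  define q where "q = givens_last_row c s m"
  define u where "u = (\<Sum>i=1..k. q i *\<^sub>R v i)"
  have "(\<Sum>i=1..k. (q i)\<^sup>2) = 1"
    using givens_last_row_norm[of m c s] givens fgmres_performs_mono[OF perf] k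
    by (auto simp: q_def fgmres_givens_def)
  then have uu: "u \<bullet> u = 1"
    unfolding u_def orthonormal_on_sum_inner_sum[OF orth finite_atLeastAtMost]
    by (simp add: power2_eq_square)
  have Az: "A *v z j = (\<Sum>i=1..k. h i j *\<^sub>R v i)" if "j \<in> {1..k}" for j
  proof -
    have "(\<Sum>i=1..k. h i j *\<^sub>R v i) = (\<Sum>i=1..k+1. h i j *\<^sub>R v i)"
      \<comment> \<open>The extra term \<open>i = k + 1\<close> is zero: by the Hessenberg form for
        \<open>j < k\<close>, by breakdown for \<open>j = k\<close>.\<close>
      using that breakdown by (cases "j = k") (simp_all add: fgmres_h_def)
    also have "\<dots> = (\<Sum>i=1..j+1. h i j *\<^sub>R v i)"
      using that by (intro sum.mono_neutral_right) (auto simp: fgmres_h_def)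
    finally show ?thesis using fgmres_arnoldi[of j] that by simp
  qed
  have u_Az: "u \<bullet> (A *v z j) = (\<Sum>i=1..k. q i * h i j)" if "j \<in> {1..k}" for j
    unfolding Az[OF that] u_def
    by (rule orthonormal_on_sum_inner_sum[OF orth finite_atLeastAtMost])
  have "u \<bullet> (A *v z j) = 0" if "j \<in> {1..<k}" for j
    using givens_last_row_annihilates[OF givens, of m j] perf that k
    by (simp add: u_Az q_def)
  then have uS: "u \<bullet> x = 0" if "x \<in> ?S" for x
    using that
    by (intro orthogonal_to_span[unfolded orthogonal_def, of x "(\<lambda>j. A *v z j) ` {1..<k}" u]) auto
  \<comment> \<open>For \<open>k = 1\<close> no rotation has been applied and the row is the single
    entry 1, which agrees with the convention \<open>c 0 = 1\<close>.\<close>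
  have qk: "q k = c (k - 1)"
    using k c0 by (cases m) (auto simp: q_def)
  have "u \<bullet> v k = q k"
    using orthonormal_on_inner_sum[OF orth, of k q] k by (simp add: u_def inner_commute)
  have t: "u \<bullet> (A *v z k) \<noteq> 0"
  proof
    assume "u \<bullet> (A *v z k) = 0"
    then have "\<bar>c (k - 1)\<bar> = \<bar>u \<bullet> (v k - A *v z k)\<bar>"
      using qk \<open>u \<bullet> v k = q k\<close> by (simp add: inner_diff_right)
    also have "\<dots> \<le> norm u * norm (v k - A *v z k)"
      by (rule Cauchy_Schwarz_ineq2)
    also have "norm u = 1" using uu by (simp add: norm_eq_1)
    finally show False using residual by simp
  qed
  have "\<forall>i\<in>{1..k}. \<exists>a. v i - a *\<^sub>R v 1 \<in> ?S"
    using fgmres_v_mod_v1[OF perf] by blast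
  then obtain a where a: "\<And>i. i \<in> {1..k} \<Longrightarrow> v i - a i *\<^sub>R v 1 \<in> ?S"
    by metis
  have comb: "(\<Sum>i=1..k. f i *\<^sub>R v i) - (\<Sum>i=1..k. f i * a i) *\<^sub>R v 1 \<in> ?S" for f
  proof -
    have "(\<Sum>i=1..k. f i *\<^sub>R (v i - a i *\<^sub>R v 1)) \<in> ?S"
      using a by (intro span_sum span_mul) auto
    also have "(\<Sum>i=1..k. f i *\<^sub>R (v i - a i *\<^sub>R v 1)) =
      (\<Sum>i=1..k. f i *\<^sub>R v i) - (\<Sum>i=1..k. f i * a i) *\<^sub>R v 1"
      unfolding scaleR_diff_right sum_subtractf scaleR_sum_left scaleR_scaleR ..
    finally show ?thesis .
  qed
  \<comment> \<open>Modulo \<open>?S\<close>, the last image is a multiple of \<open>v 1\<close>. As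
    \<open>u\<close> vanishes on \<open>?S\<close> but not on \<open>A *v z k\<close>, the factor is
    nonzero, so \<open>v 1\<close> and its multiple \<open>r0\<close> lie in
    \<open>?T\<close>.\<close>
  obtain \<gamma> where \<gamma>: "A *v z k - \<gamma> *\<^sub>R v 1 \<in> ?S"
    using comb[of "\<lambda>i. h i k"] Az[of k] k by auto
  have "u \<bullet> (A *v z k) = \<gamma> * (u \<bullet> v 1)"
    using uS[OF \<gamma>] by (simp add: inner_diff_right)
  with t have "\<gamma> \<noteq> 0" by auto
  have "?S \<subseteq> ?T" by (intro span_mono image_mono) auto
  with \<gamma> have "A *v z k - \<gamma> *\<^sub>R v 1 \<in> ?T" ..
  moreover have "A *v z k \<in> ?T" using k by (intro span_base) auto
  ultimately have "A *v z k - (A *v z k - \<gamma> *\<^sub>R v 1) \<in> ?T"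
    by (rule span_diff [rotated])
  then have "(norm r0 * inverse \<gamma>) *\<^sub>R (A *v z k - (A *v z k - \<gamma> *\<^sub>R v 1)) \<in> ?T"
    by (rule span_mul)
  also have "(norm r0 * inverse \<gamma>) *\<^sub>R (A *v z k - (A *v z k - \<gamma> *\<^sub>R v 1)) = r0"
    using perf \<open>\<gamma> \<noteq> 0\<close> by (simp add: fgmres_performs_def field_simps)
  finally show ?thesis .
qed

section \<open>The least squares problem at breakdown\<close>

text \<open>By the Arnoldi relation, the coefficients whose norm \<open>fgmres_lsq\<close> measures
  are coefficients of the true residual with respect to \<open>v\<close>.\<close>

lemma fgmres_residual_eq:
  assumes "performs k"
  shows "r0 - (\<Sum>j=1..k. y j *\<^sub>R (A *v z j)) =
    (\<Sum>i=1..k+1. ((if i = 1 then norm r0 else 0) - (\<Sum>j=1..k. h i j * y j)) *\<^sub>R v i)"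
proof -
  have "A *v z j = (\<Sum>i=1..k+1. h i j *\<^sub>R v i)" if "j \<in> {1..k}" for j
  proof -
    have "(\<Sum>i=1..k+1. h i j *\<^sub>R v i) = (\<Sum>i=1..j+1. h i j *\<^sub>R v i)"
      using that by (intro sum.mono_neutral_right) (auto simp: fgmres_h_def)
    then show ?thesis using fgmres_arnoldi[of j] that by simp
  qed
  then have "(\<Sum>j=1..k. y j *\<^sub>R (A *v z j)) = (\<Sum>j=1..k. \<Sum>i=1..k+1. (h i j * y j) *\<^sub>R v i)"
    by (intro sum.cong) (simp_all add: scaleR_sum_right mult.commute scaleR_add_right)
  also have "\<dots> = (\<Sum>i=1..k+1. (\<Sum>j=1..k. h i j * y j) *\<^sub>R v i)"
    unfolding scaleR_sum_left by (rule sum.swap)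
  finally have Az: "(\<Sum>j=1..k. y j *\<^sub>R (A *v z j)) =
    (\<Sum>i=1..k+1. (\<Sum>j=1..k. h i j * y j) *\<^sub>R v i)" .
  have "(\<Sum>i=1..k+1. (if i = 1 then norm r0 else 0) *\<^sub>R v i) =
        (\<Sum>i=1..k+1. if i = 1 then norm r0 *\<^sub>R v 1 else 0)"
    by (intro sum.cong) auto
  also have "\<dots> = norm r0 *\<^sub>R v 1" by simp
  also have "\<dots> = r0"
    using assms by (simp add: fgmres_performs_def)
  finally show ?thesis
    unfolding Az scaleR_diff_left sum_subtractf by simp
qed

lemma fgmres_minimizer_solves:
  assumes perf: "performs k" and breakdown: "h (k + 1) k = 0"
    and r0: "r0 \<in> span ((\<lambda>j. A *v z j) ` {1..k})"
    and min: "is_arg_min (fgmres_lsq A P r0 k) (\<lambda>_. True) y"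
  shows "(\<Sum>j=1..k. y j *\<^sub>R (A *v z j)) = r0"
proof -
  define g where "g y i = (if i = 1 then norm r0 else 0) - (\<Sum>j=1..k. h i j * y j)" for y i
  have res: "r0 - (\<Sum>j=1..k. y j *\<^sub>R (A *v z j)) = (\<Sum>i=1..k+1. g y i *\<^sub>R v i)" for y
    unfolding g_def by (rule fgmres_residual_eq[OF perf])
  have lsq: "fgmres_lsq A P r0 k y = L2_set (g y) {1..k+1}" for y
    unfolding fgmres_lsq_def g_def ..
  have k: "1 \<le> k" using perf by (simp add: fgmres_performs_def)
  have "(\<Sum>j=1..k. h (k + 1) j * x j) = 0" for x
    using breakdown by (intro sum.neutral) (auto simp: fgmres_h_def)
  \<comment> \<open>Row \<open>k + 1\<close> of the matrix is zero and \<open>k + 1\<close> differs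
    from 1, so only the orthonormal vectors \<open>v 1\<close>, ..., \<open>v k\<close> contribute
    to the residual.\<close>
  then have last: "g x (k + 1) = 0" for x
    using k by (simp add: g_def)
  obtain x where "r0 = (\<Sum>j=1..k. x j *\<^sub>R (A *v z j))"
    using span_image_finite_sum[OF _ r0] by auto
  with res[of x] last have zero: "(\<Sum>i=1..k. g x i *\<^sub>R v i) = 0" by simp
  have "g x i = 0" if "i \<in> {1..k+1}" for i
  proof (cases "i = k + 1")
    case False
    then have "i \<in> {1..k}" using that by auto
    from orthonormal_on_inner_sum[OF fgmres_orthonormal[OF perf] _ this, of "g x"] zero
    show ?thesis by simp
  qed (use last in simp)
  \<comment> \<open>The coefficients \<open>x\<close> attain the value 0, so every minimizer does,
    even if it differs from \<open>x\<close>.\<close>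
  then have "fgmres_lsq A P r0 k x = 0"
    by (simp add: lsq L2_set_eq_0_iff)
  moreover have "\<not> fgmres_lsq A P r0 k x < fgmres_lsq A P r0 k y"
    using min by (simp add: is_arg_min_def)
  moreover have "0 \<le> fgmres_lsq A P r0 k y"
    unfolding lsq by (rule L2_set_nonneg)
  ultimately have "fgmres_lsq A P r0 k y = 0" by linarith
  then have "g y i = 0" if "i \<in> {1..k+1}" for i
    using that unfolding lsq by (subst (asm) L2_set_eq_0_iff) auto
  then have "(\<Sum>i=1..k+1. g y i *\<^sub>R v i) = 0"
    by (intro sum.neutral) auto
  with res[of y] show ?thesis by simp
qed

end

theorem theorem3p1:
  fixes A M N H :: "real^'n^'n"
    and P :: "nat \<Rightarrow> real^'n^'n"
    and l :: "nat \<Rightarrow> nat"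
    and b x0 r0 :: "real^'n"
    and c s :: "nat \<Rightarrow> real"
  assumes "A = M - N"
    and "invertible M"
    and "H = matrix_inv M ** N"
    and "semiconvergent H"
    and "\<And>k. k \<ge> 1 \<Longrightarrow> l k \<ge> 1"
    and "P = (\<lambda>k. multistep_precond M H (l k))"
    and "b \<in> range ((*v) A)"
    and "r0 = b - A *v x0"
    and "c 0 = 1"
    and "fgmres_givens A P r0 c s"
    and "\<And>k. fgmres_performs A P r0 k \<Longrightarrow>
           norm (fgmres_v A P r0 k - A *v fgmres_z A P r0 k) < \<bar>c (k - 1)\<bar>"
  shows "fgmres_determines_solution A P b x0"
  unfolding fgmres_determines_solution_def
proof (intro allI impI)
  fix X
  assume X: "fgmres_iterates A P b x0 X"
  show "\<exists>k. (k = 0 \<or> fgmres_performs A P (b - A *v x0) k) \<and> A *v X k = b"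
  proof (cases "r0 = 0")
    case True
    then have "A *v X 0 = b"
      using X assms(8) by (simp add: fgmres_iterates_def Let_def)
    then show ?thesis by blast
  next
    case False
    then obtain k where k: "fgmres_performs A P r0 k" "fgmres_h A P r0 (k + 1) k = 0"
      by (rule fgmres_breakdown)
    obtain y where y: "is_arg_min (fgmres_lsq A P r0 k) (\<lambda>_. True) y"
      and Xk: "X k = x0 + (\<Sum>j=1..k. y j *\<^sub>R fgmres_z A P r0 j)"
      using X k(1) assms(8) by (auto simp: fgmres_iterates_def Let_def)
    have "r0 \<in> span ((\<lambda>j. A *v fgmres_z A P r0 j) ` {1..k})"
      using assms(10,9) k assms(11)[OF k(1)] by (rule fgmres_initial_residual_in_span)
    with k have "(\<Sum>j=1..k. y j *\<^sub>R (A *v fgmres_z A P r0 j)) = r0"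
      using y by (rule fgmres_minimizer_solves)
    then have "A *v X k = A *v x0 + r0"
      by (simp add: Xk matrix_vector_right_distrib linear_sum[OF matrix_vector_mul_linear]
          scaleR_matrix_vector_assoc matrix_vector_mult_scaleR)
    then have "A *v X k = b" using assms(8) by simp
    with k(1) assms(8) show ?thesis by blast
  qed
qed

end
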